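(* Let $d$ be a positive square-free integer with $d\equiv 5\pmod 8$, $K=\mathbb{Q}(\sqrt d)$, $\mathcal{O}_K=\mathbb{Z}[\frac{1+\sqrt d}{2}]$. Define integers $P_j, Q_j, q_j$ and elements $\theta_j\in K$ by $P_0=1$, $Q_0=2$, $\theta_1=1$ and, for $j\ge 0$, $q_j=\left\lfloor \frac{P_j+\sqrt d}{Q_j}\right\rfloor$, $P_{j+1}=q_jQ_j-P_j$, $Q_{j+1}=\frac{d-P_{j+1}^2}{Q_j}$, $\theta_{j+2}=\frac{P_{j+1}+\sqrt d}{Q_j}\,\theta_{j+1}$. Then for every $j\ge 1$, $\theta_j\notin 2\mathcal{O}_K$.
   Context: The recursion is the continued-fraction (infrastructure) reduction: $(\theta_1)=\mathcal{O}_K=[\frac{Q_0}{2},\frac{P_0+\sqrt d}{2}]$, and for $j\ge 0$ the element $\theta_{j+2}\in\mathcal{O}_K$ generates the principal $\mathcal{O}_K$-ideal equal to the $\mathbb{Z}$-module $[\frac{Q_{j+1}}{2},\frac{P_{j+1}+\sqrt d}{2}]$, obtained from $(\theta_{j+1})=[\frac{Q_j}{2},\frac{P_j+\sqrt d}{2}]$ by one reduction step; these ideals form the cycle of reduced principal ideals of $\mathcal{O}_K$. Here $2\mathcal{O}_K$ is the ideal generated by $2$ (a prime ideal, since $2$ is inert in $K$). *)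

theory Defs
  imports Complex_Main "HOL-Computational_Algebra.Computational_Algebra"
begin

section \<open>The real quadratic field and its ring of integers\<close>

definition quadratic_field :: "int \<Rightarrow> real set" where
  "quadratic_field d = {a + b * sqrt (of_int d) | a b. a \<in> \<rat> \<and> b \<in> \<rat>}"

definition ring_of_integers :: "real set \<Rightarrow> real set" where
  "ring_of_integers K = {x \<in> K. algebraic_int x}"

definition int_adjoin :: "real \<Rightarrow> real set" where
  "int_adjoin \<alpha> = range (\<lambda>p :: int poly. poly (map_poly of_int p) \<alpha>)"

section \<open>The continued fraction recursion\<close>

text \<open>
  The integer division in the recursion for \<open>cf_Q\<close> is exact (and the divisor nonzero) as soon as
  \<open>d mod 8 = 5\<close>: see \<open>cf_Q_Suc_real\<close> below.
\<close>

function cf_P :: "int \<Rightarrow> nat \<Rightarrow> int"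
  and cf_Q :: "int \<Rightarrow> nat \<Rightarrow> int"
  and cf_q :: "int \<Rightarrow> nat \<Rightarrow> int"
where
  "cf_P d 0 = 1"
| "cf_P d (Suc j) = cf_q d j * cf_Q d j - cf_P d j"
| "cf_Q d 0 = 2"
| "cf_Q d (Suc j) = (d - (cf_P d (Suc j))\<^sup>2) div cf_Q d j"
| "cf_q d j = \<lfloor>(of_int (cf_P d j) + sqrt (of_int d)) / of_int (cf_Q d j)\<rfloor>"
  by pat_completeness auto
termination
  by (relation "measure (\<lambda>x. case x of Inl (d, j) \<Rightarrow> 3 * j
                                  | Inr (Inl (d, j)) \<Rightarrow> 3 * j + 1
                                  | Inr (Inr (d, j)) \<Rightarrow> 3 * j + 2)") auto

text \<open>The sequence starts at index 1; the value at index 0 is unspecified.\<close>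

fun theta :: "int \<Rightarrow> nat \<Rightarrow> real" where
  "theta d (Suc 0) = 1"
| "theta d (Suc (Suc j)) =
     (of_int (cf_P d (Suc j)) + sqrt (of_int d)) / of_int (cf_Q d j) * theta d (Suc j)"

section \<open>Exactness of the division\<close>

declare cf_P.simps(2) [simp del] cf_Q.simps(2) [simp del] cf_q.simps [simp del]

lemma not_square_if_mod_8_eq_5:
  fixes d m :: int
  assumes "d mod 8 = 5"
  shows "m\<^sup>2 \<noteq> d"
proof
  assume "m\<^sup>2 = d"
  hence "(m mod 8)\<^sup>2 mod 8 = 5" using assms by (simp add: power_mod)
  moreover have "m mod 8 \<in> {0..7}" by simp
  hence "m mod 8 \<in> {0,1,2,3,4,5,6,7}" by (simp only: atLeastAtMost_iff insert_iff empty_iff) presburger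
  ultimately show False by auto
qed

lemma cf_Q_dvd:
  assumes "d mod 8 = 5"
  shows "cf_Q d j \<noteq> 0 \<and> cf_Q d j dvd d - (cf_P d j)\<^sup>2 \<and> cf_Q d j dvd d - (cf_P d (Suc j))\<^sup>2"
proof (induction j)
  case 0
  have "odd d" using assms by presburger
  thus ?case by (simp add: cf_P.simps(2))
next
  case (Suc j)
  let ?P = "cf_P d (Suc j)" and ?Q = "cf_Q d (Suc j)"
  have eq: "?Q * cf_Q d j = d - ?P\<^sup>2" using Suc by (simp add: cf_Q.simps(2))
  have nz: "?Q \<noteq> 0"
    using eq not_square_if_mod_8_eq_5[OF assms, of ?P] by auto
  have dv: "?Q dvd d - ?P\<^sup>2" using eq by (metis dvd_triv_left)
  have "d - (cf_P d (Suc (Suc j)))\<^sup>2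
      = (d - ?P\<^sup>2) + ?Q * (cf_q d (Suc j) * (2 * ?P - cf_q d (Suc j) * ?Q))"
    by (simp add: cf_P.simps(2)[of d "Suc j"] power2_eq_square algebra_simps)
  hence "?Q dvd d - (cf_P d (Suc (Suc j)))\<^sup>2" using dv by (metis dvd_add dvd_triv_left)
  with nz dv show ?case by blast
qed

lemma cf_Q_Suc_real:
  assumes "d mod 8 = 5"
  shows "cf_Q d j \<noteq> 0"
    and "real_of_int (cf_Q d (Suc j))
           = (real_of_int d - (real_of_int (cf_P d (Suc j)))\<^sup>2) / real_of_int (cf_Q d j)"
  using cf_Q_dvd[OF assms, of j]
  by (simp_all add: cf_Q.simps(2) real_of_int_div)

section \<open>The ring of integers is \<open>\<int>[(1 + \<surd>d) / 2]\<close>\<close>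

lemma sqrt_notin_Rats:
  fixes d :: int
  assumes "squarefree d" "d > 1"
  shows "sqrt (of_int d) \<notin> \<rat>"
proof
  assume "sqrt (of_int d) \<in> \<rat>"
  moreover have "algebraic_int (sqrt (of_int d))" by (intro algebraic_int_sqrt) auto
  ultimately have "sqrt (of_int d) \<in> \<int>" by (rule rational_algebraic_int_is_int[rotated])
  then obtain m where m: "sqrt (of_int d) = of_int m" by (auto elim: Ints_cases)
  have "real_of_int d = (sqrt (of_int d))\<^sup>2" using assms(2) by simp
  hence "real_of_int d = of_int (m\<^sup>2)" unfolding m by simp
  hence d: "d = m\<^sup>2" by linarith
  hence "m\<^sup>2 dvd d" by simp
  hence "m dvd 1" by (rule squarefreeD[OF assms(1)])
  hence "\<bar>m\<bar> = 1" by simp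
  hence "m\<^sup>2 = 1" by (simp add: power2_eq_1_iff abs_if split: if_splits)
  with d assms show False by simp
qed

lemma Rats_bounded_denominator_imp_Ints:
  fixes N :: real and D :: int
  assumes "N \<in> \<rat>" "D > 0" "\<And>k. of_int D * N ^ k \<in> \<int>"
  shows "N \<in> \<int>"
proof -
  obtain p q :: int where pq: "q > 0" "coprime p q" "N = of_int p / of_int q"
    using assms(1) by (auto elim: Rats_cases')
  have "q ^ k dvd D" for k
  proof -
    obtain z where "of_int D * N ^ k = real_of_int z" using assms(3)[of k] by (auto elim: Ints_cases)
    hence "real_of_int (D * p ^ k) = of_int (z * q ^ k)"
      using pq by (simp add: field_simps)
    hence "D * p ^ k = z * q ^ k" by linarith
    hence "q ^ k dvd D * p ^ k" by simp
    thus ?thesis using pq(2) by (simp add: coprime_commute coprime_dvd_mult_left_iff)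
  qed
  hence le: "q ^ k \<le> D" for k using assms(2) by (simp add: zdvd_imp_le)
  have "q = 1"
  proof (rule ccontr)
    assume "q \<noteq> 1"
    hence "q \<ge> 2" using pq by simp
    hence "2 ^ nat D \<le> q ^ nat D" by (intro power_mono) auto
    moreover have "int (nat D) < int (2 ^ nat D)" by (intro of_nat_less_iff[THEN iffD2] less_exp)
    hence "D < 2 ^ nat D" using assms(2) by simp
    ultimately show False using le[of "nat D"] by linarith
  qed
  thus ?thesis using pq by simp
qed

context
  fixes d :: int and s :: real
  assumes sqf: "squarefree d" and d1: "d > 1"
  defines "s \<equiv> sqrt (of_int d)"
begin

private lemma s2: "s * s = of_int d" using d1 by (simp add: s_def)

private lemma uniq:
  assumes "A \<in> \<rat>" "B \<in> \<rat>" "A' \<in> \<rat>" "B' \<in> \<rat>" "A + B * s = A' + B' * s"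
  shows "A = A' \<and> B = B'"
proof -
  have "B = B'"
  proof (rule ccontr)
    assume "B \<noteq> B'"
    hence "s = (A' - A) / (B - B')" using assms(5) by (simp add: field_simps)
    hence "s \<in> \<rat>" using assms by simp
    thus False using sqrt_notin_Rats[OF sqf d1] by (simp add: s_def)
  qed
  thus ?thesis using assms(5) by simp
qed

private definition "L = {of_int u + of_int v * s | u v :: int. True}"

private lemma L_add: "x \<in> L \<Longrightarrow> y \<in> L \<Longrightarrow> x + y \<in> L"
proof -
  assume "x \<in> L" "y \<in> L"
  then obtain u v u' v' where "x = of_int u + of_int v * s" "y = of_int u' + of_int v' * s"
    unfolding L_def by blast
  hence "x + y = of_int (u + u') + of_int (v + v') * s" by (simp add: algebra_simps)
  thus ?thesis unfolding L_def by blast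
qed

private lemma L_mult: "x \<in> L \<Longrightarrow> y \<in> L \<Longrightarrow> x * y \<in> L"
proof -
  assume "x \<in> L" "y \<in> L"
  then obtain u v u' v' where "x = of_int u + of_int v * s" "y = of_int u' + of_int v' * s"
    unfolding L_def by blast
  hence "x * y = of_int u * of_int u' + of_int v * of_int v' * (s * s)
           + (of_int u * of_int v' + of_int v * of_int u') * s"
    by (simp add: algebra_simps)
  also have "\<dots> = of_int (u * u' + v * v' * d) + of_int (u * v' + v * u') * s"
    unfolding s2 by simp
  finally show ?thesis unfolding L_def by blast
qed

private lemma L_int: "of_int u \<in> L"
proof -
  have "of_int u = of_int u + of_int 0 * s" by simp
  thus ?thesis unfolding L_def by blast
qed

private lemma L_pow: "x \<in> L \<Longrightarrow> x ^ k \<in> L"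
  using L_int[of 1] by (induction k) (auto intro: L_mult)

private lemma L_sum: "(\<And>i. i \<in> A \<Longrightarrow> f i \<in> L) \<Longrightarrow> sum f A \<in> L"
  using L_int[of 0] by (induction A rule: infinite_finite_induct) (auto intro: L_add)

private lemma bounded_denominator:
  assumes "a \<in> \<rat>" "b \<in> \<rat>" "algebraic_int (a + b * s)"
  shows "\<exists>D :: int. D > 0 \<and> (\<forall>k. of_int D * (a + b * s) ^ k \<in> L)"
proof -
  define x where "x = a + b * s"
  obtain a1 a2 :: int where a: "a2 > 0" "a = of_int a1 / of_int a2"
    using assms(1) by (auto elim: Rats_cases')
  obtain b1 b2 :: int where b: "b2 > 0" "b = of_int b1 / of_int b2"
    using assms(2) by (auto elim: Rats_cases')
  define E where "E = a2 * b2"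
  have E: "E > 0" using a b by (simp add: E_def)
  have "of_int E * x = of_int (a1 * b2) + of_int (b1 * a2) * s"
  proof -
    have "of_int E * x = (of_int a2 * a) * of_int b2 + (of_int b2 * b) * of_int a2 * s"
      by (simp add: E_def x_def algebra_simps)
    also have "of_int a2 * a = of_int a1" using a by simp
    also have "of_int b2 * b = of_int b1" using b by simp
    finally show ?thesis by simp
  qed
  hence Ex: "of_int E * x \<in> L" unfolding L_def by blast
  obtain p :: "int poly" where p: "poly (map_poly of_int p) x = 0" "lead_coeff p = 1"
    using assms(3) unfolding algebraic_int_altdef_ipoly x_def by blast
  define n where "n = degree p"
  define D where "D = E ^ n"
  have n: "x ^ n = (\<Sum>i<n. of_int (- coeff p i) * x ^ i)"
  proof -
    have "0 = (\<Sum>i\<le>n. of_int (coeff p i) * x ^ i)"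
      using p(1) by (simp add: poly_altdef n_def coeff_map_poly degree_map_poly)
    also have "\<dots> = (\<Sum>i<n. of_int (coeff p i) * x ^ i) + x ^ n"
      using p(2) by (simp add: n_def lessThan_Suc_atMost [symmetric])
    finally show ?thesis by (simp add: sum_negf)
  qed
  have "of_int D * x ^ k \<in> L" for k
  proof (induction k rule: less_induct)
    case (less k)
    show ?case
    proof (cases "k \<le> n")
      case True
      hence "D = E ^ (n - k) * E ^ k" unfolding D_def power_add [symmetric] by simp
      hence "of_int D * x ^ k = of_int (E ^ (n - k)) * (of_int E * x) ^ k"
        by (simp add: power_mult_distrib)
      thus ?thesis by (simp only: L_mult[OF L_int L_pow[OF Ex]])
    next
      case False
      have "x ^ k = x ^ n * x ^ (k - n)" using False unfolding power_add [symmetric] by simp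
      also have "x ^ n = (\<Sum>i<n. of_int (- coeff p i) * x ^ i)" by (rule n)
      finally have "of_int D * x ^ k
          = of_int D * ((\<Sum>i<n. of_int (- coeff p i) * x ^ i) * x ^ (k - n))" by (rule arg_cong)
      also have "\<dots> = (\<Sum>i<n. of_int (- coeff p i) * (of_int D * x ^ (i + (k - n))))"
        unfolding sum_distrib_left sum_distrib_right power_add by (intro sum.cong) (simp_all add: mult_ac)
      also have "\<dots> \<in> L"
        using False by (intro L_sum L_mult[OF L_int] less.IH) auto
      finally show ?thesis .
    qed
  qed
  moreover have "D > 0" using E by (simp add: D_def)
  ultimately show ?thesis unfolding x_def by blast
qed

private lemma norm_Ints:
  assumes ab: "a \<in> \<rat>" "b \<in> \<rat>" and D: "D > 0" "\<And>k. of_int D * (a + b * s) ^ k \<in> L"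
  shows "a\<^sup>2 - of_int d * b\<^sup>2 \<in> \<int>"
proof (rule Rats_bounded_denominator_imp_Ints[where D = "D\<^sup>2"])
  show "a\<^sup>2 - of_int d * b\<^sup>2 \<in> \<rat>" using ab by simp
  show "D\<^sup>2 > 0" using D by simp
  fix k
  have conj: "\<exists>A\<in>\<rat>. \<exists>B\<in>\<rat>. (a + b * s) ^ k = A + B * s \<and> (a - b * s) ^ k = A - B * s"
  proof (induction k)
    case 0
    show ?case by (intro bexI[of _ 1] bexI[of _ 0]) auto
  next
    case (Suc k)
    then obtain A B where AB: "A \<in> \<rat>" "B \<in> \<rat>"
      "(a + b * s) ^ k = A + B * s" "(a - b * s) ^ k = A - B * s" by blast
    have "(a + b * s) ^ Suc k = (a * A + b * B * (s * s)) + (a * B + b * A) * s"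
         "(a - b * s) ^ Suc k = (a * A + b * B * (s * s)) - (a * B + b * A) * s"
      by (simp_all add: AB algebra_simps)
    moreover have "a * A + b * B * (s * s) \<in> \<rat>" "a * B + b * A \<in> \<rat>"
      unfolding s2 using ab AB by auto
    ultimately show ?case by blast
  qed
  then obtain A B where AB: "A \<in> \<rat>" "B \<in> \<rat>"
    "(a + b * s) ^ k = A + B * s" "(a - b * s) ^ k = A - B * s" by blast
  obtain u v where uv: "of_int D * (a + b * s) ^ k = of_int u + of_int v * s"
    using D(2)[of k] unfolding L_def by blast
  hence "of_int D * A + of_int D * B * s = of_int u + of_int v * s" by (simp add: AB algebra_simps)
  hence DAB: "of_int D * A = of_int u" "of_int D * B = of_int v"
    using uniq[of "of_int D * A" "of_int D * B" "of_int u" "of_int v"] AB by auto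
  have "a\<^sup>2 - of_int d * b\<^sup>2 = (a + b * s) * (a - b * s)"
    by (simp add: power2_eq_square algebra_simps flip: s2)
  hence "of_int (D\<^sup>2) * (a\<^sup>2 - of_int d * b\<^sup>2) ^ k
       = (of_int D * (a + b * s) ^ k) * (of_int D * (a - b * s) ^ k)"
    by (simp add: power_mult_distrib power2_eq_square)
  also have "\<dots> = (of_int D * A + of_int D * B * s) * (of_int D * A - of_int D * B * s)"
    by (simp add: AB algebra_simps)
  also have "\<dots> = (of_int u)\<^sup>2 - (of_int v)\<^sup>2 * (s * s)"
    unfolding DAB by (simp add: power2_eq_square algebra_simps)
  also have "\<dots> = of_int (u\<^sup>2 - v\<^sup>2 * d)" by (simp add: s2)
  finally show "of_int (D\<^sup>2) * (a\<^sup>2 - of_int d * b\<^sup>2) ^ k \<in> \<int>" by simp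
qed

private lemma trace_norm_Ints:
  assumes ab: "a \<in> \<rat>" "b \<in> \<rat>" and "algebraic_int (a + b * s)"
  shows "2 * a \<in> \<int>" "a\<^sup>2 - of_int d * b\<^sup>2 \<in> \<int>"
proof -
  obtain D where D: "D > 0" "\<And>k. of_int D * (a + b * s) ^ k \<in> L"
    using bounded_denominator[OF assms] by blast
  show N: "a\<^sup>2 - of_int d * b\<^sup>2 \<in> \<int>" by (rule norm_Ints[OF ab D])
  have "of_int D * (a + b * s) ^ j * (a + 1 + b * s) ^ k \<in> L" for j k
  proof (induction k arbitrary: j)
    case 0
    show ?case using D(2)[of j] by simp
  next
    case (Suc k)
    have "of_int D * (a + b * s) ^ j * (a + 1 + b * s) ^ Suc k
        = of_int D * (a + b * s) ^ Suc j * (a + 1 + b * s) ^ k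
          + of_int D * (a + b * s) ^ j * (a + 1 + b * s) ^ k"
      by (simp add: algebra_simps)
    thus ?case using L_add[OF Suc.IH[of "Suc j"] Suc.IH[of j]] by simp
  qed
  from this[of 0] have "of_int D * (a + 1 + b * s) ^ k \<in> L" for k by simp
  hence "(a + 1)\<^sup>2 - of_int d * b\<^sup>2 \<in> \<int>" by (intro norm_Ints[OF _ _ D(1)]) (use ab in auto)
  from Ints_diff[OF Ints_diff[OF this N] Ints_1]
  show "2 * a \<in> \<int>" by (simp add: power2_eq_square algebra_simps)
qed

private lemma half_integers:
  fixes b :: real
  assumes "b \<in> \<rat>" "of_int d * (2 * b)\<^sup>2 \<in> \<int>"
  shows "2 * b \<in> \<int>"
proof -
  have "2 * b \<in> \<rat>" using assms by simp
  then obtain p q :: int where pq: "q > 0" "coprime p q" "2 * b = of_int p / of_int q"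
    by (auto elim: Rats_cases')
  obtain z where "of_int d * (2 * b)\<^sup>2 = real_of_int z" using assms(2) by (auto elim: Ints_cases)
  hence "real_of_int (d * p\<^sup>2) = of_int (z * q\<^sup>2)" unfolding pq(3) using pq(1)
    by (simp add: field_simps)
  hence "d * p\<^sup>2 = z * q\<^sup>2" by linarith
  hence "q\<^sup>2 dvd d * p\<^sup>2" by simp
  hence "q\<^sup>2 dvd d" using pq(2) by (simp add: coprime_commute coprime_dvd_mult_left_iff)
  hence "q dvd 1" by (rule squarefreeD[OF sqf])
  hence "q = 1" using pq(1) by simp
  thus ?thesis using pq(3) by simp
qed

lemma ring_of_integers_quadratic_field_basis:
  assumes "d mod 4 = 1"
  shows "ring_of_integers (quadratic_field d)
       = {of_int m + of_int n * ((1 + sqrt (of_int d)) / 2) | m n :: int. True}" (is "?O = ?R")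
proof (rule set_eqI, rule iffI)
  fix x assume "x \<in> ?O"
  then obtain a b where ab: "a \<in> \<rat>" "b \<in> \<rat>" "x = a + b * s" and "algebraic_int (a + b * s)"
    unfolding ring_of_integers_def quadratic_field_def s_def by auto
  note tn = trace_norm_Ints[OF ab(1,2) this(4)]
  obtain T where T: "2 * a = real_of_int T" using tn(1) by (auto elim: Ints_cases)
  obtain N where N: "a\<^sup>2 - of_int d * b\<^sup>2 = real_of_int N" using tn(2) by (auto elim: Ints_cases)
  have eq: "of_int d * (2 * b)\<^sup>2 = (2 * a)\<^sup>2 - 4 * real_of_int N"
    by (simp add: power2_eq_square flip: N)
  hence "of_int d * (2 * b)\<^sup>2 \<in> \<int>" unfolding T by simp
  then obtain M where M: "2 * b = real_of_int M"
    using half_integers[OF ab(2)] by (auto elim: Ints_cases)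
  have "real_of_int (d * M\<^sup>2) = of_int (T\<^sup>2 - 4 * N)" using eq unfolding T M by simp
  hence dM: "d * M\<^sup>2 = T\<^sup>2 - 4 * N" by linarith
  have "odd d" using assms by presburger
  have "even (d * M\<^sup>2) \<longleftrightarrow> even (T\<^sup>2 - 4 * N)" using dM by simp
  hence "even (T - M)" using \<open>odd d\<close> by simp
  then obtain m where m: "T - M = 2 * m" by (elim evenE)
  have "x = of_int m + of_int M * ((1 + s) / 2)"
  proof -
    have "2 * real_of_int m = of_int T - of_int M" using m by linarith
    hence "real_of_int m = a - b" by (simp flip: T M)
    thus ?thesis by (simp add: ab(3) algebra_simps add_divide_distrib flip: M)
  qed
  thus "x \<in> ?R" unfolding s_def by blast
next
  fix x assume "x \<in> ?R"
  then obtain m n :: int where x: "x = of_int m + of_int n * ((1 + s) / 2)"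
    unfolding s_def by blast
  obtain e where e: "d = 4 * e + 1" using assms by (metis mult_div_mod_eq)
  have "x = (of_int m + of_int n / 2) + (of_int n / 2) * s"
    by (simp add: x field_simps)
  moreover have "of_int m + of_int n / 2 \<in> (\<rat> :: real set)" "of_int n / 2 \<in> (\<rat> :: real set)" by auto
  ultimately have "x \<in> quadratic_field d" unfolding quadratic_field_def s_def by blast
  moreover have "algebraic_int x"
    unfolding algebraic_int_altdef_ipoly
  proof (intro exI conjI)
    let ?p = "[:m\<^sup>2 + m * n - e * n\<^sup>2, - (2 * m + n), 1:] :: int poly"
    have ss: "s * s = 4 * of_int e + 1" using s2 by (simp add: e)
    have "poly (map_poly of_int ?p) x
        = of_int m * of_int m + of_int m * of_int n - of_int e * (of_int n * of_int n)
           - (2 * of_int m + of_int n) * x + x * x"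
      by (simp add: map_poly_pCons power2_eq_square algebra_simps)
    also have "\<dots> = of_int n * of_int n * (s * s - 1 - 4 * of_int e) / 4"
      unfolding x by (simp add: field_simps)
    finally show "poly (map_poly of_int ?p) x = 0" by (simp add: ss)
    show "lead_coeff ?p = 1" by simp
  qed
  ultimately show "x \<in> ?O" by (simp add: ring_of_integers_def)
qed

theorem ring_of_integers_quadratic_field:
  assumes "d mod 4 = 1"
  shows "ring_of_integers (quadratic_field d) = int_adjoin ((1 + sqrt (of_int d)) / 2)"
proof -
  define w where "w = (1 + s) / 2"
  let ?R = "{of_int m + of_int n * w | m n :: int. True}"
  obtain e where e: "d = 4 * e + 1" using assms by (metis mult_div_mod_eq)
  have w2: "w * w = w + of_int e" using s2 by (simp add: e w_def field_simps)
  have "poly (map_poly of_int p) w \<in> ?R" for p :: "int poly"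
  proof (induction p)
    case 0
    have "poly (map_poly of_int (0 :: int poly)) w = of_int 0 + of_int 0 * w" by simp
    thus ?case by blast
  next
    case (pCons c p)
    then obtain m n :: int where mn: "poly (map_poly of_int p) w = of_int m + of_int n * w" by blast
    have "poly (map_poly of_int (pCons c p)) w = of_int c + w * poly (map_poly of_int p) w"
      using pCons.hyps by (simp add: map_poly_pCons)
    also have "\<dots> = of_int c + of_int m * w + of_int n * (w * w)"
      unfolding mn by (simp add: algebra_simps)
    also have "\<dots> = of_int (c + n * e) + of_int (m + n) * w"
      unfolding w2 by (simp add: algebra_simps)
    finally show ?case by blast
  qed
  moreover have "of_int m + of_int n * w = poly (map_poly of_int [:m, n:]) w" for m n :: int
    by (simp add: map_poly_pCons)
  ultimately have "int_adjoin w = ?R" unfolding int_adjoin_def by blast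
  thus ?thesis using ring_of_integers_quadratic_field_basis[OF assms] by (simp add: s_def w_def)
qed

end

end

theory Submission
  imports Defs
begin

text \<open>
  Both generators of \<open>[Q\<^sub>j/2, (P\<^sub>j + \<surd>d)/2]\<close> are multiples of \<open>\<theta>\<^bsub>j+1\<^esub>\<close> in the ring of integers,
  so \<open>\<theta>\<^bsub>j+1\<^esub>\<close> being divisible by 2 would make \<open>(P\<^sub>j + \<surd>d)/4\<close> an integer of the field. But the
  coefficient of \<open>\<surd>d\<close> in an integer of the field is half an integer.
\<close>

text \<open>In the basis \<open>1, w\<close> with \<open>w = (1 + sqrt d) / 2\<close>, closure
  reduces to \<open>w * w = w + e\<close>, where \<open>d = 4 * e + 1\<close>.\<close>

lemma ring_of_integers_quadratic_field_mult:
  assumes "squarefree d" "d > 1" "d mod 4 = 1"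
    and "x \<in> ring_of_integers (quadratic_field d)" "y \<in> ring_of_integers (quadratic_field d)"
  shows "x * y \<in> ring_of_integers (quadratic_field d)"
proof -
  define w where "w = (1 + sqrt (real_of_int d)) / 2"
  note basis = ring_of_integers_quadratic_field_basis[OF assms(1-3), folded w_def]
  obtain e where e: "d = 4 * e + 1" using assms(3) by (metis mult_div_mod_eq)
  have "sqrt (real_of_int d) * sqrt (real_of_int d) = of_int d" using assms(2) by simp
  hence w2: "w * w = w + of_int e" by (simp add: e w_def field_simps)
  obtain m n m' n' :: int where xy: "x = of_int m + of_int n * w" "y = of_int m' + of_int n' * w"
    using assms(4,5) unfolding basis by blast
  have "x * y = of_int m * of_int m' + of_int n * of_int n' * (w * w)
      + (of_int m * of_int n' + of_int n * of_int m') * w"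
    unfolding xy by (simp only: algebra_simps)
  also have "\<dots> = of_int (m * m' + n * n' * e) + of_int (m * n' + n * m' + n * n') * w"
    unfolding w2 by (simp add: algebra_simps)
  finally show ?thesis unfolding basis by blast
qed

lemma ring_of_integers_quadratic_field_diff:
  assumes "squarefree d" "d > 1" "d mod 4 = 1"
    and "x \<in> ring_of_integers (quadratic_field d)" "y \<in> ring_of_integers (quadratic_field d)"
  shows "x - y \<in> ring_of_integers (quadratic_field d)"
proof -
  define w where "w = (1 + sqrt (real_of_int d)) / 2"
  note basis = ring_of_integers_quadratic_field_basis[OF assms(1-3), folded w_def]
  obtain m n m' n' :: int where xy: "x = of_int m + of_int n * w" "y = of_int m' + of_int n' * w"
    using assms(4,5) unfolding basis by blast
  have "x - y = of_int (m - m') + of_int (n - n') * w" unfolding xy by (simp add: algebra_simps)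
  thus ?thesis unfolding basis by blast
qed

lemma of_int_in_ring_of_integers: "of_int n \<in> ring_of_integers (quadratic_field d)"
proof -
  have "of_int n = of_int n + 0 * sqrt (of_int d)" by simp
  hence "of_int n \<in> quadratic_field d"
    unfolding quadratic_field_def using Rats_of_int Rats_0 by blast
  thus ?thesis by (simp add: ring_of_integers_def int_imp_algebraic_int)
qed

text \<open>Induction along the reduction steps. The factor \<phi> =
  \<open>theta d (Suc (Suc j)) / theta d (Suc j)\<close> carries elements of the old module to the
  generators of the new one, so the new cofactors are integral combinations of the old ones.\<close>

lemma theta_dvd_ideal_generators:
  fixes d :: int
  assumes "d > 0" "squarefree d" "d mod 8 = 5"
  defines "O_K \<equiv> ring_of_integers (quadratic_field d)"
  shows "(\<exists>\<alpha>\<in>O_K. of_int (cf_Q d j) / 2 = theta d (Suc j) * \<alpha>) \<and>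
         (\<exists>\<beta>\<in>O_K. (of_int (cf_P d j) + sqrt (of_int d)) / 2 = theta d (Suc j) * \<beta>)"
proof -
  have d: "d > 1" "d mod 4 = 1" using assms(1,3) by presburger+
  show ?thesis
  proof (induction j)
    case 0
    have "1 \<in> O_K" using of_int_in_ring_of_integers[of 1 d] by (simp add: O_K_def)
    moreover have "(1 + sqrt (of_int d)) / 2 \<in> O_K"
    proof -
      have "O_K = {of_int m + of_int n * ((1 + sqrt (of_int d)) / 2) | m n :: int. True}"
        unfolding O_K_def by (intro ring_of_integers_quadratic_field_basis assms d)
      moreover have "(1 + sqrt (of_int d)) / 2 = of_int 0 + of_int 1 * ((1 + sqrt (of_int d)) / 2)"
        by simp
      ultimately show ?thesis by blast
    qed
    moreover have "real_of_int (cf_Q d 0) / 2 = theta d (Suc 0) * 1"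
      and "(of_int (cf_P d 0) + sqrt (of_int d)) / 2
         = theta d (Suc 0) * ((1 + sqrt (of_int d)) / 2)"
      by simp_all
    ultimately show ?case by blast
  next
    case (Suc j)
    let ?s = "sqrt (of_int d)"
    define \<phi> where "\<phi> = (of_int (cf_P d (Suc j)) + ?s) / of_int (cf_Q d j)"
    obtain \<alpha> \<beta> where \<alpha>: "\<alpha> \<in> O_K" "of_int (cf_Q d j) / 2 = theta d (Suc j) * \<alpha>"
      and \<beta>: "\<beta> \<in> O_K" "(of_int (cf_P d j) + ?s) / 2 = theta d (Suc j) * \<beta>"
      using Suc.IH by blast
    have Q: "real_of_int (cf_Q d j) \<noteq> 0" using cf_Q_Suc_real(1)[OF assms(3)] by simp
    have s2: "?s * ?s = of_int d" using assms(1) by simp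
    have theta: "theta d (Suc (Suc j)) = \<phi> * theta d (Suc j)" by (simp add: \<phi>_def)
    \<comment> \<open>The new second generator is \<phi> times the old first one, so \<alpha> is
      reused unchanged as its cofactor.\<close>
    have "(of_int (cf_P d (Suc j)) + ?s) / 2 = \<phi> * (of_int (cf_Q d j) / 2)"
      using Q by (simp add: \<phi>_def)
    also have "\<dots> = theta d (Suc (Suc j)) * \<alpha>" unfolding \<alpha>(2) theta by (simp only: mult.assoc)
    finally have P': "(of_int (cf_P d (Suc j)) + ?s) / 2 = theta d (Suc (Suc j)) * \<alpha>" .
    \<comment> \<open>The exact division gives \<open>Q_j * Q_(j+1) = d - P_(j+1)^2 = (s - P_(j+1))
      * (s + P_(j+1))\<close> with \<open>s = sqrt d\<close>; dividing by \<open>2 * Q_j\<close>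
      leaves \<phi> times half the factor \<open>s - P_(j+1)\<close>.\<close>
    have "real_of_int (cf_Q d (Suc j)) / 2 = \<phi> * ((?s - of_int (cf_P d (Suc j))) / 2)"
      using Q s2 by (simp add: cf_Q_Suc_real(2)[OF assms(3)] \<phi>_def power2_eq_square field_simps)
    \<comment> \<open>Since \<open>P_(j+1) = q_j * Q_j - P_j\<close>, this factor lies in the old
      module, which yields the cofactor \<beta> - \<open>q_j\<close> * \<alpha>.\<close>
    also have "(?s - of_int (cf_P d (Suc j))) / 2
        = (of_int (cf_P d j) + ?s) / 2 - of_int (cf_q d j) * (of_int (cf_Q d j) / 2)"
      by (simp add: cf_P.simps(2) field_simps)
    also have "\<phi> * \<dots> = theta d (Suc (Suc j)) * (\<beta> - of_int (cf_q d j) * \<alpha>)"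
      unfolding \<alpha>(2) \<beta>(2) theta by (simp only: algebra_simps)
    finally have "real_of_int (cf_Q d (Suc j)) / 2
        = theta d (Suc (Suc j)) * (\<beta> - of_int (cf_q d j) * \<alpha>)" .
    moreover have "\<beta> - of_int (cf_q d j) * \<alpha> \<in> O_K"
      using \<alpha>(1) \<beta>(1) unfolding O_K_def
      by (intro ring_of_integers_quadratic_field_diff ring_of_integers_quadratic_field_mult
          of_int_in_ring_of_integers assms d)
    ultimately show ?case using P' \<alpha>(1) by blast
  qed
qed

theorem theoremA1:
  fixes d :: int and j :: nat
  assumes "d > 0" and "squarefree d" and "d mod 8 = 5" and "j \<ge> 1"
  shows "theta d j \<notin> (*) 2 ` ring_of_integers (quadratic_field d)"
proof
  let ?s = "sqrt (of_int d)"
  define O_K where "O_K = ring_of_integers (quadratic_field d)"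
  assume "theta d j \<in> (*) 2 ` ring_of_integers (quadratic_field d)"
  then obtain \<gamma> where \<gamma>: "\<gamma> \<in> O_K" "theta d j = 2 * \<gamma>" by (auto simp: O_K_def)
  \<comment> \<open>The shift matches \<open>theta d (Suc i)\<close> with the module of index
    \<open>i\<close>; index 0 of \<open>theta\<close> is unspecified.\<close>
  obtain i where i: "j = Suc i" using assms(4) by (cases j) auto
  obtain \<beta> where \<beta>: "\<beta> \<in> O_K" "(of_int (cf_P d i) + ?s) / 2 = theta d j * \<beta>"
    using theta_dvd_ideal_generators[OF assms(1-3), of i] unfolding O_K_def i by blast
  have d: "d > 1" "d mod 4 = 1" using assms(1,3) by presburger+
  have "\<gamma> * \<beta> \<in> O_K"
    using \<gamma>(1) \<beta>(1) unfolding O_K_def by (intro ring_of_integers_quadratic_field_mult assms d)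
  then obtain m n :: int where mn: "\<gamma> * \<beta> = of_int m + of_int n * ((1 + ?s) / 2)"
    unfolding O_K_def ring_of_integers_quadratic_field_basis[OF assms(2) d] by blast
  have "(of_int (cf_P d i) + ?s) / 2 = 2 * (\<gamma> * \<beta>)" by (simp add: \<beta>(2) \<gamma>(2))
  \<comment> \<open>Doubling gives \<open>P_i + s = 4 * m + 2 * n + 2 * n * s\<close>. The
    coefficients 1 and \<open>2 * n\<close> of \<open>s\<close> differ by parity, so solving for
    \<open>s\<close> would make it rational.\<close>
  hence eq: "of_int (1 - 2 * n) * ?s = of_int (4 * m + 2 * n - cf_P d i)"
    unfolding mn by (simp add: field_simps)
  have "1 - 2 * n \<noteq> 0" by presburger
  hence "real_of_int (1 - 2 * n) \<noteq> 0" by (simp only: of_int_eq_0_iff not_False_eq_True)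
  hence "?s = of_int (4 * m + 2 * n - cf_P d i) / of_int (1 - 2 * n)"
    unfolding eq [symmetric] by (rule nonzero_mult_div_cancel_left [symmetric])
  hence "?s \<in> \<rat>" by (simp only: Rats_divide Rats_of_int)
  thus False using sqrt_notin_Rats[OF assms(2) d(1)] by blast
qed

end
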